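(* Let $t\ge 2$ and $n\ge 1$ be integers and let $(a_1,\dots,a_n)$ be a sequence of positive integers. Then $$M'(t,n,a_1,\dots,a_n)=U'(t,n,a_1,\dots,a_n):=\sum_{j=0}^{t}\left[\binom{t}{j}\,j!\sum_{1\le i_1<\cdots<i_{n-j}\le n}a_{i_1}\cdots a_{i_{n-j}}\right],$$ and $\bar F$ is the only valued $(t,n)$-family $F$ with valuation $(a_1,\dots,a_n)$ satisfying $N(F)=M'(t,n,a_1,\dots,a_n)$; that is, a valued $(t,n)$-family $F=(A_1,\dots,A_n)$ with valuation $(a_1,\dots,a_n)$ satisfies $N(F)=M'(t,n,a_1,\dots,a_n)$ if and only if $\left|\bigcap_{i\in I}A_i\right|=t$ for every $I\subseteq\{1,\dots,n\}$ with $|I|\ge 2$.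
   Context: A system of distinct representatives (SDR) of a family of sets $F=(A_1,\dots,A_n)$ is a sequence $(x_1,\dots,x_n)$ of $n$ pairwise distinct elements with $x_i\in A_i$ for $1\le i\le n$. $N(F)$ denotes the number of SDRs of $F$; two SDRs are distinct if they differ in at least one component. For a nonnegative integer $t$ and a sequence of positive integers $(a_1,\dots,a_n)$, a family $F=(A_1,\dots,A_n)$ is a valued $(t,n)$-family with valuation $(a_1,\dots,a_n)$ if $|A_i|=a_i+t$ for each $1\le i\le n$, and $\left|\bigcup_{i\in I}A_i\right|\ge \sum_{i\in I}a_i+t$ for every $I\subseteq\{1,\dots,n\}$ with $|I|\ge 2$. $M'(t,n,a_1,\dots,a_n)$ is the minimum of $N(F)$ over all valued $(t,n)$-families $F$ with valuation $(a_1,\dots,a_n)$. $\bar F$ denotes a valued $(t,n)$-family $(A_1,\dots,A_n)$ with valuation $(a_1,\dots,a_n)$ such that $\left|\bigcap_{i\in I}A_i\right|=t$ for every $I\subseteq\{1,\dots,n\}$ with $|I|\ge 2$ (it is unique up to renaming elements). In the formula for $U'$, the inner sum ranges over all $(n-j)$-element subsets of $\{1,\dots,n\}$; it equals $1$ (empty product) when $j=n$ and $0$ when $j>n$. *)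

theory Defs
  imports Main "HOL-Library.FuncSet" "HOL-Library.Countable_Set" "HOL-Library.Nat_Bijection"
begin

text \<open>A family \<open>(A\<^sub>1, \<dots>, A\<^sub>n)\<close> is a function on \<open>nat\<close> of which only the values on \<open>{1..n}\<close> matter,
  and so is a valuation. Systems of distinct representatives are taken as extensional functions
  (undefined outside \<open>{1..n}\<close>), so that two of them are equal iff all \<open>n\<close> components agree.\<close>

definition SDRs :: "nat \<Rightarrow> (nat \<Rightarrow> 'a set) \<Rightarrow> (nat \<Rightarrow> 'a) set" where
  "SDRs n A = {x \<in> (\<Pi>\<^sub>E i\<in>{1..n}. A i). inj_on x {1..n}}"

definition num_SDRs :: "nat \<Rightarrow> (nat \<Rightarrow> 'a set) \<Rightarrow> nat" where
  "num_SDRs n A = card (SDRs n A)"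

text \<open>For positive valuations, the condition on \<open>card (A i)\<close> forces the sets to be finite.\<close>

definition valued_family :: "nat \<Rightarrow> nat \<Rightarrow> (nat \<Rightarrow> nat) \<Rightarrow> (nat \<Rightarrow> 'a set) \<Rightarrow> bool" where
  "valued_family t n a A \<longleftrightarrow>
     (\<forall>i\<in>{1..n}. card (A i) = a i + t) \<and>
     (\<forall>I\<subseteq>{1..n}. card I \<ge> 2 \<longrightarrow> card (\<Union>i\<in>I. A i) \<ge> (\<Sum>i\<in>I. a i) + t)"

text \<open>The minimum is taken over families of sets of natural numbers; by \<open>M'_attained\<close> and \<open>M'_le\<close>
  below it is attained, and it is a lower bound for families over an arbitrary type.\<close>

definition M' :: "nat \<Rightarrow> nat \<Rightarrow> (nat \<Rightarrow> nat) \<Rightarrow> nat" where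
  "M' t n a = (LEAST m. \<exists>A :: nat \<Rightarrow> nat set. valued_family t n a A \<and> num_SDRs n A = m)"

text \<open>Writing \<open>card S + j = n\<close> instead of \<open>card S = n - j\<close> makes the inner sum empty for \<open>j > n\<close>.\<close>

definition U' :: "nat \<Rightarrow> nat \<Rightarrow> (nat \<Rightarrow> nat) \<Rightarrow> nat" where
  "U' t n a = (\<Sum>j=0..t. (t choose j) * fact j *
                 (\<Sum>S | S \<subseteq> {1..n} \<and> card S + j = n. \<Prod>i\<in>S. a i))"

definition is_F_bar :: "nat \<Rightarrow> nat \<Rightarrow> (nat \<Rightarrow> nat) \<Rightarrow> (nat \<Rightarrow> 'a set) \<Rightarrow> bool" where
  "is_F_bar t n a A \<longleftrightarrow> valued_family t n a A \<and>
     (\<forall>I\<subseteq>{1..n}. card I \<ge> 2 \<longrightarrow> card (\<Inter>i\<in>I. A i) = t)"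

lemma ex_valued_family: "\<exists>A :: nat \<Rightarrow> nat set. valued_family t n a A"
proof -
  define g where "g = (\<lambda>p. t + prod_encode p)"
  have g: "inj_on g X" for X
    by (auto simp: g_def inj_on_def)
  define A where "A i = {..<t} \<union> g ` ({i} \<times> {..<a i})" for i
  have un: "(\<Union>i\<in>I. A i) = {..<t} \<union> g ` (SIGMA i:I. {..<a i})" if "I \<noteq> {}" for I
    using that by (fastforce simp: A_def)
  have c: "card ({..<t} \<union> g ` X) = t + card X" if "finite X" for X
  proof -
    have "card ({..<t} \<union> g ` X) = card {..<t} + card (g ` X)"
      using that by (intro card_Un_disjoint) (auto simp: g_def)
    then show ?thesis
      by (simp add: card_image[OF g])
  qed
  have "valued_family t n a A"
    unfolding valued_family_def
  proof (intro conjI ballI allI impI)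
    fix i show "card (A i) = a i + t"
      by (simp add: A_def c card_cartesian_product)
  next
    fix I assume I: "I \<subseteq> {1..n}" "2 \<le> card I"
    then have "finite I" "I \<noteq> {}"
      by (auto intro: finite_subset)
    then show "(\<Sum>i\<in>I. a i) + t \<le> card (\<Union>i\<in>I. A i)"
      by (simp add: un c)
  qed
  then show ?thesis by blast
qed

lemma M'_attained: "\<exists>A :: nat \<Rightarrow> nat set. valued_family t n a A \<and> num_SDRs n A = M' t n a"
  unfolding M'_def by (rule LeastI_ex) (use ex_valued_family in blast)

lemma num_SDRs_image:
  assumes f: "inj_on f (\<Union>i\<in>{1..n}. A i)"
  shows "num_SDRs n (\<lambda>i. f ` A i) = num_SDRs n A"
proof -
  let ?h = "\<lambda>g x. restrict (g \<circ> x) {1..n}"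
  let ?g = "inv_into (\<Union>i\<in>{1..n}. A i) f"
  have gf: "?g (f y) = y" if "y \<in> A i" "i \<in> {1..n}" for i y
    using that by (intro inv_into_f_f[OF f]) auto
  have fg: "?g y \<in> A i \<and> f (?g y) = y" if "y \<in> f ` A i" "i \<in> {1..n}" for i y
    using that gf by auto
  have "bij_betw (?h f) (SDRs n A) (SDRs n (\<lambda>i. f ` A i))"
  proof (rule bij_betw_byWitness[where f' = "?h ?g"])
    show "\<forall>x\<in>SDRs n A. ?h ?g (?h f x) = x"
    proof
      fix x assume x: "x \<in> SDRs n A"
      show "?h ?g (?h f x) = x"
      proof
        fix i show "?h ?g (?h f x) i = x i"
          using x gf[of "x i" i]
          by (cases "i \<in> {1..n}") (auto simp: SDRs_def PiE_def extensional_def Pi_def)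
      qed
    qed
    show "\<forall>x\<in>SDRs n (\<lambda>i. f ` A i). ?h f (?h ?g x) = x"
    proof
      fix x assume x: "x \<in> SDRs n (\<lambda>i. f ` A i)"
      show "?h f (?h ?g x) = x"
      proof
        fix i show "?h f (?h ?g x) i = x i"
        proof (cases "i \<in> {1..n}")
          case True
          then have "x i \<in> f ` A i"
            using x by (auto simp: SDRs_def PiE_def Pi_def)
          then show ?thesis
            using fg[of "x i" i] True by simp
        next
          case False
          then show ?thesis
            using x by (auto simp: SDRs_def PiE_def extensional_def)
        qed
      qed
    qed
    show "?h f ` SDRs n A \<subseteq> SDRs n (\<lambda>i. f ` A i)"
    proof
      fix z assume "z \<in> ?h f ` SDRs n A"
      then obtain x where x: "x \<in> SDRs n A" and z: "z = ?h f x" by blast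
      have m: "x i \<in> A i" if "i \<in> {1..n}" for i
        using x that by (auto simp: SDRs_def PiE_def Pi_def)
      have "inj_on z {1..n}"
      proof (rule inj_onI)
        fix i j assume ij: "i \<in> {1..n}" "j \<in> {1..n}" "z i = z j"
        then have "x i = x j"
          using gf[OF m[OF ij(1)] ij(1)] gf[OF m[OF ij(2)] ij(2)] ij(3)
          unfolding z restrict_apply'[OF ij(1)] restrict_apply'[OF ij(2)] comp_apply by argo
        then show "i = j"
          using x ij(1,2) unfolding SDRs_def by (blast dest: inj_onD)
      qed
      then show "z \<in> SDRs n (\<lambda>i. f ` A i)"
        unfolding SDRs_def z using m by (simp add: Pi_iff PiE_def)
    qed
    show "?h ?g ` SDRs n (\<lambda>i. f ` A i) \<subseteq> SDRs n A"
    proof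
      fix z assume "z \<in> ?h ?g ` SDRs n (\<lambda>i. f ` A i)"
      then obtain x where x: "x \<in> SDRs n (\<lambda>i. f ` A i)" and z: "z = ?h ?g x" by blast
      have m: "x i \<in> f ` A i" if "i \<in> {1..n}" for i
        using x that by (auto simp: SDRs_def PiE_def Pi_def)
      have "inj_on z {1..n}"
      proof (rule inj_onI)
        fix i j assume ij: "i \<in> {1..n}" "j \<in> {1..n}" "z i = z j"
        then have "x i = x j"
          using fg[OF m[OF ij(1)] ij(1)] fg[OF m[OF ij(2)] ij(2)] ij(3)
          unfolding z restrict_apply'[OF ij(1)] restrict_apply'[OF ij(2)] comp_apply by argo
        then show "i = j"
          using x ij(1,2) unfolding SDRs_def by (blast dest: inj_onD)
      qed
      then show "z \<in> SDRs n A"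
        unfolding SDRs_def z using fg[OF m] by (simp add: Pi_iff PiE_def)
    qed
  qed
  then show ?thesis
    unfolding num_SDRs_def by (metis bij_betw_same_card)
qed

lemma M'_le:
  fixes A :: "nat \<Rightarrow> 'a set"
  assumes pos: "\<And>i. i \<in> {1..n} \<Longrightarrow> a i > 0" and A: "valued_family t n a A"
  shows "M' t n a \<le> num_SDRs n A"
proof -
  have fin: "finite (A i)" if "i \<in> {1..n}" for i
    using A pos[OF that] that by (intro card_ge_0_finite) (auto simp: valued_family_def)
  then obtain f :: "'a \<Rightarrow> nat" where f: "inj_on f (\<Union>i\<in>{1..n}. A i)"
    using countableE[OF countable_finite, of "\<Union>i\<in>{1..n}. A i"] by auto
  have ci: "card (f ` X) = card X" if "X \<subseteq> (\<Union>i\<in>{1..n}. A i)" for X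
    using inj_on_subset[OF f that] by (rule card_image)
  have "valued_family t n a (\<lambda>i. f ` A i)"
    unfolding valued_family_def
  proof (intro conjI ballI allI impI)
    fix i assume "i \<in> {1..n}"
    then have "card (f ` A i) = card (A i)"
      by (intro ci) blast
    then show "card (f ` A i) = a i + t"
      using A \<open>i \<in> {1..n}\<close> by (simp add: valued_family_def)
  next
    fix I assume I: "I \<subseteq> {1..n}" "2 \<le> card I"
    have "card (\<Union>i\<in>I. f ` A i) = card (\<Union>i\<in>I. A i)"
      using ci[OF UN_mono[OF I(1) order_refl]] by (simp only: image_UN)
    then show "(\<Sum>i\<in>I. a i) + t \<le> card (\<Union>i\<in>I. f ` A i)"
      using A I by (simp add: valued_family_def)
  qed
  then have "M' t n a \<le> num_SDRs n (\<lambda>i. f ` A i)"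
    unfolding M'_def by (intro Least_le) blast
  then show ?thesis
    by (simp only: num_SDRs_image[OF f])
qed

end

theory Submission
  imports Defs
begin

text \<open>The lower bound \<open>N(F) \<ge> U'(t)\<close> is proved by induction on \<open>t\<close>, for all families with
  \<open>|A(I)| \<ge> a(I) + t\<close> for every nonempty \<open>I\<close>, where \<open>A(I)\<close> is the union of the \<open>A\<^sub>i\<close> and \<open>a(I)\<close> the sum of
  the \<open>a\<^sub>i\<close> over \<open>I\<close>. For \<open>t = 0\<close> the bound \<open>\<Prod>a\<^sub>i\<close> follows as in the Halmos--Vaughan proof of Hall's
  theorem. Since \<open>U'(t + 1) = U'(t) + (\<Sum>j. U'(t) without j)\<close>, for the step it suffices to remove one
  element from every set, keeping the surplus \<open>t\<close>, such that the new family \<open>F\<^sup>0\<close> satisfies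
  \<open>N(F) \<ge> N(F\<^sup>0) + (\<Sum>j. N(F\<^sup>0 without j))\<close>. The sets are processed in groups: an element \<open>y\<close> is removed from
  all unprocessed sets that contain it, and these become processed. With \<open>R\<close> the processed indices and
  \<open>B\<close> the current family, the potential \<open>N(B) + (\<Sum>j\<in>R. N(B without j))\<close> never increases, and the
  surplus is kept iff \<open>y\<close> is a good element in the sense below; a good element always exists, in fact
  at least \<open>t + 1\<close> of them.

  If equality holds then the potential is constant, so that for \<open>t \<ge> 1\<close> every good element of the second
  step lies in all sets processed in the first step. As the first element \<open>y\<close> is arbitrary and
  \<open>|A\<^sub>i \<inter> A\<^sub>j| \<le> t + 1\<close>, every element lies in all sets or in only one.\<close>

section \<open>Counting SDRs over an arbitrary index set\<close>

definition sdrs :: "'i set \<Rightarrow> ('i \<Rightarrow> 'a set) \<Rightarrow> ('i \<Rightarrow> 'a) set" where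
  "sdrs J A = {x \<in> (\<Pi>\<^sub>E i\<in>J. A i). inj_on x J}"

definition nsdr :: "'i set \<Rightarrow> ('i \<Rightarrow> 'a set) \<Rightarrow> nat" where
  "nsdr J A = card (sdrs J A)"

lemma num_SDRs_eq_nsdr: "num_SDRs n A = nsdr {1..n} A"
  by (simp add: num_SDRs_def nsdr_def SDRs_def sdrs_def)

lemma finite_sdrs:
  assumes "finite J" "\<And>i. i \<in> J \<Longrightarrow> finite (A i)"
  shows "finite (sdrs J A)"
  by (rule finite_subset[OF _ finite_PiE[OF assms]]) (auto simp: sdrs_def)

lemma nsdr_empty [simp]: "nsdr {} A = 1"
  by (simp add: nsdr_def sdrs_def)

text \<open>Deleting component \<open>k\<close> is a bijection whose inverse puts \<open>y\<close>
  back; injectivity of \<open>x\<close> keeps the other components away from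
  \<open>y\<close>.\<close>

lemma card_sdrs_fixed:
  assumes J: "finite J" "k \<in> J" and y: "y \<in> A k"
  shows "card {x \<in> sdrs J A. x k = y} = nsdr (J - {k}) (\<lambda>i. A i - {y})"
proof -
  let ?C = "sdrs (J - {k}) (\<lambda>i. A i - {y})"
  have "bij_betw (\<lambda>x. restrict x (J - {k})) {x \<in> sdrs J A. x k = y} ?C"
  proof (rule bij_betw_byWitness[where f' = "\<lambda>x. x(k := y)"])
    show "\<forall>x\<in>{x \<in> sdrs J A. x k = y}. (restrict x (J - {k}))(k := y) = x"
      using J by (auto simp: sdrs_def PiE_def extensional_def fun_eq_iff)
    show "\<forall>x\<in>?C. restrict (x(k := y)) (J - {k}) = x"
      by (auto simp: sdrs_def PiE_def extensional_def fun_eq_iff)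
    show "(\<lambda>x. restrict x (J - {k})) ` {x \<in> sdrs J A. x k = y} \<subseteq> ?C"
    proof clarify
      fix x assume x: "x \<in> sdrs J A" "y = x k"
      then have "inj_on x J" "x \<in> Pi J A" by (auto simp: sdrs_def PiE_def)
      moreover have "x i \<noteq> x k" if "i \<in> J" "i \<noteq> k" for i
        using that \<open>inj_on x J\<close> J(2) by (auto dest: inj_onD)
      ultimately show "restrict x (J - {k}) \<in> sdrs (J - {k}) (\<lambda>i. A i - {x k})"
        by (auto simp: sdrs_def PiE_def Pi_def inj_on_def)
    qed
    show "(\<lambda>x. x(k := y)) ` ?C \<subseteq> {x \<in> sdrs J A. x k = y}"
    proof clarify
      fix x assume x: "x \<in> ?C"
      then have *: "inj_on x (J - {k})" "x \<in> extensional (J - {k})"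
        "\<And>i. i \<in> J \<Longrightarrow> i \<noteq> k \<Longrightarrow> x i \<in> A i \<and> x i \<noteq> y"
        by (auto simp: sdrs_def PiE_def Pi_def)
      have "inj_on (x(k := y)) J"
        using *(1,3) by (auto simp: inj_on_def)
      then show "x(k := y) \<in> sdrs J A \<and> (x(k := y)) k = y"
        using * y J by (auto simp: sdrs_def PiE_def Pi_def extensional_def)
    qed
  qed
  then show ?thesis
    unfolding nsdr_def by (rule bij_betw_same_card)
qed

lemma nsdr_fix_index:
  assumes J: "finite J" "\<And>i. i \<in> J \<Longrightarrow> finite (A i)" and k: "k \<in> J"
  shows "nsdr J A = (\<Sum>y\<in>A k. nsdr (J - {k}) (\<lambda>i. A i - {y}))"
proof -
  let ?F = "\<lambda>y. {x \<in> sdrs J A. x k = y}"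
  have "sdrs J A = (\<Union>y\<in>A k. ?F y)"
    using k by (auto simp: sdrs_def)
  moreover have "card (\<Union>y\<in>A k. ?F y) = (\<Sum>y\<in>A k. card (?F y))"
    using finite_sdrs[OF J] J(2)[OF k] by (intro card_UN_disjoint) auto
  ultimately have "nsdr J A = (\<Sum>y\<in>A k. card (?F y))"
    unfolding nsdr_def by argo
  also have "\<dots> = (\<Sum>y\<in>A k. nsdr (J - {k}) (\<lambda>i. A i - {y}))"
    by (intro sum.cong refl card_sdrs_fixed[where A = A]) (use J k in auto)
  finally show ?thesis .
qed

text \<open>An SDR either uses \<open>y\<close> at no index of \<open>Y\<close>, and is then an SDR
  of \<open>B\<close>, or at exactly one \<open>k\<close> in \<open>Y\<close>, which bars
  \<open>y\<close> from all other sets, also from those outside \<open>Y\<close>.\<close>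

lemma nsdr_remove:
  assumes J: "finite J" "\<And>i. i \<in> J \<Longrightarrow> finite (A i)"
    and Y: "Y \<subseteq> J" "\<And>i. i \<in> Y \<Longrightarrow> y \<in> A i"
    and B: "\<And>i. i \<in> J \<Longrightarrow> B i = (if i \<in> Y then A i - {y} else A i)"
  shows "nsdr J A = nsdr J B + (\<Sum>k\<in>Y. nsdr (J - {k}) (\<lambda>i. A i - {y}))"
proof -
  let ?F = "\<lambda>k. {x \<in> sdrs J A. x k = y}"
  have mem: "x \<in> sdrs J B \<longleftrightarrow> x \<in> sdrs J A \<and> (\<forall>k\<in>Y. x k \<noteq> y)" for x
    using Y(1) B unfolding sdrs_def PiE_def Pi_def by (auto split: if_splits)
  then have eq: "sdrs J A = sdrs J B \<union> (\<Union>k\<in>Y. ?F k)" and disj: "sdrs J B \<inter> (\<Union>k\<in>Y. ?F k) = {}"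
    by blast+
  have fin: "finite (sdrs J A)" "finite Y"
    using finite_sdrs[OF J] Y(1) J(1) finite_subset by auto
  have "card (\<Union>k\<in>Y. ?F k) = (\<Sum>k\<in>Y. card (?F k))"
  proof (rule card_UN_disjoint)
    show "\<forall>i\<in>Y. \<forall>j\<in>Y. i \<noteq> j \<longrightarrow> ?F i \<inter> ?F j = {}"
      using Y(1) by (auto simp: sdrs_def dest: inj_onD)
  qed (use fin in auto)
  also have "\<dots> = (\<Sum>k\<in>Y. nsdr (J - {k}) (\<lambda>i. A i - {y}))"
    by (intro sum.cong refl card_sdrs_fixed) (use J Y in auto)
  finally have sum: "card (\<Union>k\<in>Y. ?F k) = (\<Sum>k\<in>Y. nsdr (J - {k}) (\<lambda>i. A i - {y}))" .
  have "finite (sdrs J B \<union> (\<Union>k\<in>Y. ?F k))"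
    using fin(1) eq by argo
  then have "card (sdrs J B \<union> (\<Union>k\<in>Y. ?F k)) = card (sdrs J B) + card (\<Union>k\<in>Y. ?F k)"
    by (intro card_Un_disjoint disj) (simp_all only: finite_Un)
  then show ?thesis
    unfolding nsdr_def[of J] sum eq[symmetric] .
qed

section \<open>A recursion for \<open>U'\<close>\<close>

fun U_rec :: "('i \<Rightarrow> nat) \<Rightarrow> nat \<Rightarrow> 'i set \<Rightarrow> nat" where
  "U_rec a 0 J = (\<Prod>i\<in>J. a i)"
| "U_rec a (Suc t) J = U_rec a t J + (\<Sum>i\<in>J. U_rec a t (J - {i}))"

text \<open>Both sides count injections of \<open>k\<close> points into \<open>Suc t\<close> points;
  the new point is missed or is hit by one of the \<open>k\<close>.\<close>

lemma choose_fact_Suc: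
  "(Suc t choose k) * fact k = (t choose k) * fact k + k * ((t choose (k - 1)) * fact (k - 1))"
  by (cases k) (simp_all add: algebra_simps)

text \<open>\<open>S\<close> collects the indices represented outside the kernel; those in
  \<open>J - S\<close> receive distinct kernel elements.\<close>

lemma U_rec_eq:
  assumes "finite J"
  shows "U_rec a t J = (\<Sum>S\<in>Pow J. (t choose card (J - S)) * fact (card (J - S)) * (\<Prod>i\<in>S. a i))"
  using assms
proof (induction t arbitrary: J)
  case 0
  have "(0 choose card (J - S)) * fact (card (J - S)) * (\<Prod>i\<in>S. a i)
      = (if S = J then \<Prod>i\<in>J. a i else 0)" if "S \<in> Pow J" for S
  proof (cases "S = J")
    case False
    then have "card (J - S) > 0"
      using that 0 by (auto simp: card_gt_0_iff)
    then show ?thesis using False by simp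
  qed simp
  then show ?case
    using 0 by (simp add: sum.delta)
next
  case (Suc t)
  let ?w = "\<lambda>k S. (t choose k) * fact k * (\<Prod>i\<in>S. a i)"
  have "(\<Sum>i\<in>J. U_rec a t (J - {i})) = (\<Sum>i\<in>J. \<Sum>S\<in>Pow (J - {i}). ?w (card (J - {i} - S)) S)"
    using Suc by simp
  also have "\<dots> = (\<Sum>i\<in>J. \<Sum>S | S \<in> Pow J \<and> i \<in> J - S. ?w (card (J - S) - 1) S)"
  proof (intro sum.cong refl)
    fix i S assume "i \<in> J" "S \<in> {S \<in> Pow J. i \<in> J - S}"
    then have "card (J - {i} - S) = card (J - S) - 1"
      using Suc.prems by (metis (no_types, lifting) Diff_insert Diff_insert2 card_Diff_singleton mem_Collect_eq)
    then show "?w (card (J - {i} - S)) S = ?w (card (J - S) - 1) S" by simp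
  qed auto
  also have "\<dots> = (\<Sum>S\<in>Pow J. \<Sum>i | i \<in> J \<and> i \<in> J - S. ?w (card (J - S) - 1) S)"
    using Suc.prems by (subst sum.swap_restrict) simp_all
  also have "\<dots> = (\<Sum>S\<in>Pow J. card (J - S) * ?w (card (J - S) - 1) S)"
    by (intro sum.cong refl) (simp add: set_diff_eq)
  finally have "U_rec a (Suc t) J = (\<Sum>S\<in>Pow J. ?w (card (J - S)) S + card (J - S) * ?w (card (J - S) - 1) S)"
    using Suc by (simp add: sum.distrib)
  also have "\<dots> = (\<Sum>S\<in>Pow J. (Suc t choose card (J - S)) * fact (card (J - S)) * (\<Prod>i\<in>S. a i))"
    by (intro sum.cong refl, subst choose_fact_Suc) (simp only: algebra_simps)
  finally show ?case .
qed

lemma U'_eq_U_rec: "U' t n a = U_rec a t {1..n}"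
proof -
  let ?J = "{1..n}"
  have c: "card (?J - S) = j \<longleftrightarrow> card S + j = n" if "S \<subseteq> ?J" for S j
    using card_Diff_subset[OF finite_subset[OF that] that] card_mono[OF _ that] by auto
  have "U' t n a = (\<Sum>j\<in>{0..t}. \<Sum>S | S \<in> Pow ?J \<and> card (?J - S) = j.
      (t choose card (?J - S)) * fact (card (?J - S)) * (\<Prod>i\<in>S. a i))"
    unfolding U'_def sum_distrib_left
  proof (intro sum.cong refl)
    fix j
    show "{S. S \<subseteq> ?J \<and> card S + j = n} = {S \<in> Pow ?J. card (?J - S) = j}"
      using c by blast
  qed auto
  also have "\<dots> = (\<Sum>S\<in>Pow ?J. \<Sum>j | j \<in> {0..t} \<and> card (?J - S) = j.
      (t choose card (?J - S)) * fact (card (?J - S)) * (\<Prod>i\<in>S. a i))"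
    by (subst sum.swap_restrict) simp_all
  also have "\<dots> = U_rec a t ?J"
    unfolding U_rec_eq[OF finite_atLeastAtMost]
  proof (intro sum.cong refl)
    fix S assume "S \<in> Pow ?J"
    \<comment> \<open>If more than \<open>t\<close> indices are missing from \<open>S\<close>, the
      inner sum is empty and the binomial coefficient is zero.\<close>
    have "{j \<in> {0..t}. card (?J - S) = j} = (if card (?J - S) \<le> t then {card (?J - S)} else {})"
      by auto
    then show "(\<Sum>j | j \<in> {0..t} \<and> card (?J - S) = j.
        (t choose card (?J - S)) * fact (card (?J - S)) * (\<Prod>i\<in>S. a i))
      = (t choose card (?J - S)) * fact (card (?J - S)) * (\<Prod>i\<in>S. a i)"
      by simp
  qed
  finally show ?thesis .
qed

text \<open>The sets form a sunflower with kernel \<open>T\<close> and petals of size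
  \<open>a i\<close>. Removing one kernel element from all sets reproduces the recursion of
  \<open>U_rec\<close>; with empty kernel every choice is injective.\<close>

lemma nsdr_core:
  assumes "finite J" "finite T" "\<And>i. i \<in> J \<Longrightarrow> finite (A i) \<and> T \<subseteq> A i \<and> card (A i) = a i + card T"
    and "\<And>i j. i \<in> J \<Longrightarrow> j \<in> J \<Longrightarrow> i \<noteq> j \<Longrightarrow> A i \<inter> A j \<subseteq> T"
  shows "nsdr J A = U_rec a (card T) J"
  using assms(2,1,3,4)
proof (induction T arbitrary: A J rule: finite_induct)
  case empty
  have "sdrs J A = (\<Pi>\<^sub>E i\<in>J. A i)"
    unfolding sdrs_def PiE_def Pi_def inj_on_def using empty(3) by fastforce
  then show ?case
    using empty by (simp add: nsdr_def card_PiE)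
next
  case (insert x T)
  let ?A = "\<lambda>i. A i - {x}"
  have IH: "nsdr I ?A = U_rec a (card T) I" if "I \<subseteq> J" for I
  proof (rule insert.IH)
    show "finite I" using insert.prems(1) that finite_subset by blast
    show "finite (?A i) \<and> T \<subseteq> ?A i \<and> card (?A i) = a i + card T" if "i \<in> I" for i
      using insert.prems(2)[of i] insert.hyps \<open>I \<subseteq> J\<close> that by (auto simp: card_Diff_singleton)
    show "?A i \<inter> ?A j \<subseteq> T" if "i \<in> I" "j \<in> I" "i \<noteq> j" for i j
      using insert.prems(3)[of i j] \<open>I \<subseteq> J\<close> that by auto
  qed
  have "nsdr J A = nsdr J ?A + (\<Sum>k\<in>J. nsdr (J - {k}) ?A)"
    by (rule nsdr_remove) (use insert.prems in auto)
  then show ?case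
    using insert.hyps by (simp add: IH)
qed

section \<open>Families with surplus\<close>

text \<open>Unlike in a valued family, sizes are only bounded below, and single sets fall under the
  union condition; so subfamilies stay in the class, and removals do at the cost of surplus.\<close>

definition surplus :: "('i \<Rightarrow> nat) \<Rightarrow> nat \<Rightarrow> 'i set \<Rightarrow> ('i \<Rightarrow> 'a set) \<Rightarrow> bool" where
  "surplus a t J A \<longleftrightarrow> finite J \<and> (\<forall>i\<in>J. finite (A i)) \<and>
     (\<forall>I\<subseteq>J. I \<noteq> {} \<longrightarrow> (\<Sum>i\<in>I. a i) + t \<le> card (\<Union>(A ` I)))"

lemma surplus_subset: "surplus a t J A \<Longrightarrow> I \<subseteq> J \<Longrightarrow> surplus a t I A"
  unfolding surplus_def by (meson finite_subset subset_eq)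

lemma surplus_mono: "surplus a t J A \<Longrightarrow> t' \<le> t \<Longrightarrow> surplus a t' J A"
  unfolding surplus_def by (meson add_left_mono order_trans)

lemma surplus_cong:
  assumes "surplus a t J A" and eq: "\<And>i. i \<in> J \<Longrightarrow> B i = A i"
  shows "surplus a t J B"
proof -
  have "B ` I = A ` I" if "I \<subseteq> J" for I
    using that eq by (intro image_cong) auto
  then show ?thesis
    using assms unfolding surplus_def by simp
qed

lemma surplus_remove:
  assumes "surplus a (Suc t) J A"
  shows "surplus a t J (\<lambda>i. A i - {y})"
  unfolding surplus_def
proof (intro conjI allI impI)
  fix I assume "I \<subseteq> J" "I \<noteq> {}"
  then have "(\<Sum>i\<in>I. a i) + Suc t \<le> card (\<Union>(A ` I))"
    using assms unfolding surplus_def by blast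
  moreover have "\<Union>((\<lambda>i. A i - {y}) ` I) = \<Union>(A ` I) - {y}"
    by blast
  ultimately show "(\<Sum>i\<in>I. a i) + t \<le> card (\<Union>((\<lambda>i. A i - {y}) ` I))"
    using diff_card_le_card_Diff[of "{y}" "\<Union>(A ` I)"] by simp
qed (use assms in \<open>auto simp: surplus_def\<close>)

section \<open>Surplus 0: Hall's theorem with a count\<close>

lemma nsdr_split:
  assumes J: "finite J" "\<And>i. i \<in> J \<Longrightarrow> finite (A i)" and I: "I \<subseteq> J"
  shows "nsdr I A * nsdr (J - I) (\<lambda>i. A i - \<Union>(A ` I)) \<le> nsdr J A"
proof -
  let ?h = "\<lambda>(x, y) i. if i \<in> I then x i else y i"
  let ?X = "sdrs I A" and ?Y = "sdrs (J - I) (\<lambda>i. A i - \<Union>(A ` I))"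
  have X: "x i \<in> A i" "x i = x j \<longleftrightarrow> i = j" if "x \<in> ?X" "i \<in> I" "j \<in> I" for x i j
    using that by (auto simp: sdrs_def dest: inj_onD)
  have Y: "y i \<in> A i" "\<And>j. j \<in> I \<Longrightarrow> y i \<notin> A j" "y i = y j \<longleftrightarrow> i = j"
    if "y \<in> ?Y" "i \<in> J - I" "j \<in> J - I" for y i j
    using that by (auto simp: sdrs_def dest: inj_onD)
  have "inj_on ?h (?X \<times> ?Y)"
  proof (rule inj_onI)
    fix p p' assume p: "p \<in> ?X \<times> ?Y" "p' \<in> ?X \<times> ?Y" "?h p = ?h p'"
    obtain x y x' y' where eq: "p = (x, y)" "p' = (x', y')"
      by (cases p, cases p')
    have *: "x \<in> ?X" "y \<in> ?Y" "x' \<in> ?X" "y' \<in> ?Y" "?h (x, y) = ?h (x', y')"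
      using p unfolding eq by auto
    \<comment> \<open>The glued function hides \<open>x\<close> outside \<open>I\<close> and
      \<open>y\<close> inside \<open>I\<close>, but there they are \<open>undefined\<close>.\<close>
    have **: "x i = x' i \<and> y i = y' i" for i
    proof -
      have "(if i \<in> I then x i else y i) = (if i \<in> I then x' i else y' i)"
        using fun_cong[OF *(5), of i] by simp
      then show ?thesis
        using *(1-4) by (cases "i \<in> I") (auto simp: sdrs_def PiE_def extensional_def)
    qed
    then show "p = p'"
      unfolding eq by (simp add: fun_eq_iff)
  qed
  moreover have "?h ` (?X \<times> ?Y) \<subseteq> sdrs J A"
  proof (rule image_subsetI)
    fix p assume "p \<in> ?X \<times> ?Y"
    then obtain x y where p: "p = (x, y)" and xy: "x \<in> ?X" "y \<in> ?Y"
      by blast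
    let ?z = "\<lambda>i. if i \<in> I then x i else y i"
    have "inj_on ?z J"
    proof (rule inj_onI)
      fix i j assume "i \<in> J" "j \<in> J" "?z i = ?z j"
      then show "i = j"
        using X[OF xy(1)] Y[OF xy(2)] by (cases "i \<in> I"; cases "j \<in> I") (simp_all, metis+)
    qed
    moreover have "?z \<in> (\<Pi>\<^sub>E i\<in>J. A i)"
      using X(1)[OF xy(1)] Y(1)[OF xy(2)] xy(2) I
      by (auto simp: PiE_def Pi_def extensional_def sdrs_def)
    ultimately show "?h p \<in> sdrs J A"
      by (simp add: sdrs_def p)
  qed
  ultimately have "card (?X \<times> ?Y) \<le> card (sdrs J A)"
    by (rule card_inj_on_le) (intro finite_sdrs J)
  then show ?thesis
    by (simp add: nsdr_def card_cartesian_product)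
qed

text \<open>If the union over some proper nonempty \<open>I\<close> has exactly a(I) elements, the
  rest can avoid that union and keep its bounds, so the counts multiply. Otherwise every proper
  subfamily has an element to spare, and each of the at least \<open>a k\<close> choices for an
  index \<open>k\<close> can be made.\<close>

lemma prod_le_nsdr:
  assumes "surplus a 0 J A"
  shows "(\<Prod>i\<in>J. a i) \<le> nsdr J A"
proof -
  have "finite J"
    using assms by (simp add: surplus_def)
  then show ?thesis
    using assms
  proof (induction J arbitrary: A rule: finite_psubset_induct)
    case (psubset J)
    have fin: "finite J" "\<And>i. i \<in> J \<Longrightarrow> finite (A i)"
      using psubset.prems unfolding surplus_def by auto
    have le: "(\<Sum>i\<in>I. a i) \<le> card (\<Union>(A ` I))" if "I \<subseteq> J" for I
      using psubset.prems that unfolding surplus_def by (cases "I = {}") auto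
    show ?case
    proof (cases "\<exists>I. I \<subset> J \<and> I \<noteq> {} \<and> card (\<Union>(A ` I)) = (\<Sum>i\<in>I. a i)")
      case True
      then obtain I where I: "I \<subset> J" "I \<noteq> {}" "card (\<Union>(A ` I)) = (\<Sum>i\<in>I. a i)"
        by blast
      let ?A = "\<lambda>i. A i - \<Union>(A ` I)"
      have finI: "finite I" "finite (\<Union>(A ` I))"
      proof -
        show "finite I"
          using I(1) fin(1) by (auto intro: finite_subset)
        then show "finite (\<Union>(A ` I))"
          using I(1) fin(2) by blast
      qed
      have "surplus a 0 (J - I) ?A"
        unfolding surplus_def
      proof (intro conjI allI impI)
        fix K assume K: "K \<subseteq> J - I"
        have "(\<Sum>i\<in>K. a i) + (\<Sum>i\<in>I. a i) = (\<Sum>i\<in>K \<union> I. a i)"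
          using K finite_subset[OF _ fin(1)] finI by (intro sum.union_disjoint[symmetric]) auto
        also have "\<dots> \<le> card (\<Union>(A ` (K \<union> I)))"
          using K I(1) by (intro le) auto
        also have "\<Union>(A ` (K \<union> I)) = \<Union>(?A ` K) \<union> \<Union>(A ` I)"
          by blast
        also have "card \<dots> \<le> card (\<Union>(?A ` K)) + card (\<Union>(A ` I))"
          by (rule card_Un_le)
        finally show "(\<Sum>i\<in>K. a i) + 0 \<le> card (\<Union>(?A ` K))"
          using I(3) by simp
      qed (use fin in auto)
      then have "(\<Prod>i\<in>J - I. a i) \<le> nsdr (J - I) ?A"
        using I by (intro psubset.IH) auto
      moreover have "(\<Prod>i\<in>I. a i) \<le> nsdr I A"
        using I psubset.prems by (intro psubset.IH) (auto intro: surplus_subset)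
      ultimately have "(\<Prod>i\<in>I. a i) * (\<Prod>i\<in>J - I. a i) \<le> nsdr J A"
        using nsdr_split[OF fin, where I = I] I(1) by (meson mult_le_mono order_trans psubset_imp_subset)
      then show ?thesis
        using prod.subset_diff[of I J a] I(1) fin(1) by (simp add: mult.commute psubset_imp_subset)
    next
      case False
      show ?thesis
      proof (cases "J = {}")
        case False
        then obtain k where k: "k \<in> J" by blast
        have less: "(\<Prod>i\<in>J - {k}. a i) \<le> nsdr (J - {k}) (\<lambda>i. A i - {y})" for y
        proof (intro psubset.IH surplus_remove)
          show "surplus a (Suc 0) (J - {k}) A"
            unfolding surplus_def
          proof (intro conjI allI impI)
            fix I assume "I \<subseteq> J - {k}" "I \<noteq> {}"
            then have "card (\<Union>(A ` I)) \<noteq> (\<Sum>i\<in>I. a i)" "(\<Sum>i\<in>I. a i) \<le> card (\<Union>(A ` I))"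
              using \<open>\<not> (\<exists>I. _ I)\<close> k le[of I] by blast+
            then show "(\<Sum>i\<in>I. a i) + Suc 0 \<le> card (\<Union>(A ` I))"
              by simp
          qed (use fin in auto)
        qed (use k in auto)
        have "(\<Prod>i\<in>J. a i) = a k * (\<Prod>i\<in>J - {k}. a i)"
          using fin(1) k by (rule prod.remove)
        also have "\<dots> \<le> card (A k) * (\<Prod>i\<in>J - {k}. a i)"
          using le[of "{k}"] k by (intro mult_right_mono) auto
        also have "\<dots> = (\<Sum>y\<in>A k. \<Prod>i\<in>J - {k}. a i)"
          by simp
        also have "\<dots> \<le> (\<Sum>y\<in>A k. nsdr (J - {k}) (\<lambda>i. A i - {y}))"
          by (intro sum_mono less)
        also have "\<dots> = nsdr J A"
          by (rule nsdr_fix_index[symmetric]) (use fin k in auto)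
        finally show ?thesis .
      qed simp
    qed
  qed
qed

section \<open>Peeling\<close>

text \<open>\<open>R\<close> holds the processed indices. Unprocessed sets have lost nothing yet and
  keep surplus \<open>Suc s\<close> among themselves; a subfamily with processed sets is only
  guaranteed \<open>s\<close>.\<close>

locale peeling =
  fixes N R :: "'i set" and B :: "'i \<Rightarrow> 'a set" and a :: "'i \<Rightarrow> nat" and s :: nat
  assumes surplus: "surplus a s N B" and surplus_Suc: "surplus a (Suc s) (N - R) B" and RN: "R \<subseteq> N"
begin

lemma finN: "finite N" and finB: "\<And>i. i \<in> N \<Longrightarrow> finite (B i)"
  and lower: "\<And>I. I \<subseteq> N \<Longrightarrow> I \<noteq> {} \<Longrightarrow> (\<Sum>i\<in>I. a i) + s \<le> card (\<Union>(B ` I))"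
  and lower_Suc: "\<And>I. I \<subseteq> N - R \<Longrightarrow> I \<noteq> {} \<Longrightarrow> (\<Sum>i\<in>I. a i) + Suc s \<le> card (\<Union>(B ` I))"
  using surplus surplus_Suc unfolding surplus_def by blast+

definition tight :: "'i set \<Rightarrow> bool" where
  "tight I \<longleftrightarrow> I \<subseteq> N \<and> I \<noteq> {} \<and> card (\<Union>(B ` I)) = (\<Sum>i\<in>I. a i) + s"

text \<open>Removing \<open>y\<close> from the unprocessed sets must not lower the union of a tight subfamily, so \<open>y\<close> has
  to remain in one of its processed sets.\<close>

definition good :: "'i set \<Rightarrow> 'a set" where
  "good D = {y \<in> \<Union>(B ` (D - R)). \<forall>J\<subseteq>D. tight J \<longrightarrow> y \<in> \<Union>(B ` (J - R)) \<longrightarrow> y \<in> \<Union>(B ` (J \<inter> R))}"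

lemma finite_UN_B: "I \<subseteq> N \<Longrightarrow> finite (\<Union>(B ` I))"
  using finN finB by (auto intro: finite_subset)

text \<open>Uncrossing: the size of unions is submodular and the sum of \<open>a\<close> is modular,
  so the lower bounds for \<open>I \<union> J\<close> and \<open>I \<inter> J\<close> must both be
  attained.\<close>

lemma tight_Un_Int:
  assumes I: "tight I" and J: "tight J" and IJ: "I \<inter> J \<noteq> {}"
  shows "tight (I \<union> J)" "tight (I \<inter> J)" "\<Union>(B ` I) \<inter> \<Union>(B ` J) = \<Union>(B ` (I \<inter> J))"
proof -
  let ?u = "\<lambda>I. \<Union>(B ` I)"
  have N: "I \<subseteq> N" "J \<subseteq> N" and fin: "finite I" "finite J" and u: "finite (?u I)" "finite (?u J)"
    using I J finN finite_UN_B unfolding tight_def by (auto intro: finite_subset)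
  have "card (?u I) + card (?u J) = card (?u (I \<union> J)) + card (?u I \<inter> ?u J)"
    using card_Un_Int[OF u] by (simp add: image_Un)
  moreover have sub: "?u (I \<inter> J) \<subseteq> ?u I \<inter> ?u J" by blast
  then have "card (?u (I \<inter> J)) \<le> card (?u I \<inter> ?u J)"
    using u by (intro card_mono) auto
  moreover have "sum a I + sum a J = sum a (I \<union> J) + sum a (I \<inter> J)"
    using sum.union_inter[OF fin] by metis
  moreover have "sum a (I \<union> J) + s \<le> card (?u (I \<union> J))" "sum a (I \<inter> J) + s \<le> card (?u (I \<inter> J))"
    using lower[of "I \<union> J"] lower[of "I \<inter> J"] N IJ by blast+
  ultimately have eq: "card (?u (I \<union> J)) = sum a (I \<union> J) + s"
      "card (?u (I \<inter> J)) = sum a (I \<inter> J) + s" "card (?u (I \<inter> J)) = card (?u I \<inter> ?u J)"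
    using I J unfolding tight_def by linarith+
  show "tight (I \<union> J)" "tight (I \<inter> J)"
    using eq(1,2) N IJ unfolding tight_def by auto
  show "?u I \<inter> ?u J = ?u (I \<inter> J)"
    using card_subset_eq[OF _ sub eq(3)] u by simp
qed

text \<open>Take a proper tight subset \<open>D1\<close> of maximal size that is not contained in \<open>R\<close>, together with the
  maximal ones disjoint from it. These sets \<open>E\<close> are pairwise disjoint, and an element that is good
  in one of them but not in \<open>D\<close> occurs in another one without being good there. So the elements of
  the union that are not good in \<open>D\<close> are covered by the elements of the \<open>E\<close> that are not good in \<open>E\<close>,
  of which there are at most \<open>a(E) - 1\<close> by induction.\<close>

lemma card_good:
  assumes "D \<subseteq> N" "D - R \<noteq> {}"
  shows "Suc s \<le> card (good D)"
  using assms
proof (induction "card D" arbitrary: D rule: less_induct)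
  case less
  let ?u = "\<lambda>I. \<Union>(B ` I)"
  \<comment> \<open>Only these subfamilies constrain \<open>good D\<close>: for
    \<open>J \<subseteq> R\<close> the condition is vacuous.\<close>
  define act where "act J \<longleftrightarrow> tight J \<and> J \<subseteq> D \<and> J - R \<noteq> {}" for J
  have finD: "finite D" and fin: "\<And>I. I \<subseteq> D \<Longrightarrow> finite (?u I)"
    using less.prems(1) finN finite_UN_B by (auto intro: finite_subset)
  have good_sub: "good I \<subseteq> ?u I" for I
    unfolding good_def by blast
  show ?case
  proof (cases "\<exists>J. act J \<and> J \<noteq> D")
    case False
    then have inact: "J = D \<or> J \<subseteq> R" if "tight J" "J \<subseteq> D" for J
      using that unfolding act_def by blast
    have DR: "(\<Sum>i\<in>D - R. a i) + Suc s \<le> card (?u (D - R))"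
      using less.prems by (intro lower_Suc) auto
    show ?thesis
    proof (cases "tight D")
      case False
      then have "good D = ?u (D - R)"
        using inact unfolding good_def by blast
      then show ?thesis
        using DR by simp
    next
      case True
      \<comment> \<open>Here \<open>D\<close> itself is the only constraint, and it is met by
        elements that also lie in a processed set. Inclusion-exclusion over the two parts of
        \<open>D\<close> yields at least \<open>Suc s\<close> of them.\<close>
      have "?u (D - R) \<inter> ?u (D \<inter> R) \<subseteq> good D"
        using inact unfolding good_def by blast
      then have "card (?u (D - R) \<inter> ?u (D \<inter> R)) \<le> card (good D)"
        using finite_subset[OF good_sub fin[OF order_refl]] by (intro card_mono)
      moreover have "D \<inter> R \<noteq> {}"
      proof
        assume "D \<inter> R = {}"
        then have "D \<subseteq> N - R" "D \<noteq> {}" using less.prems by auto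
        then show False
          using lower_Suc[of D] True unfolding tight_def by simp
      qed
      then have "(\<Sum>i\<in>D \<inter> R. a i) + s \<le> card (?u (D \<inter> R))"
        using less.prems by (intro lower) auto
      moreover have "card (?u (D - R)) + card (?u (D \<inter> R)) = card (?u D) + card (?u (D - R) \<inter> ?u (D \<inter> R))"
      proof -
        have "?u D = ?u (D - R) \<union> ?u (D \<inter> R)" by blast
        then show ?thesis
          using card_Un_Int[of "?u (D - R)" "?u (D \<inter> R)"] fin by (metis Diff_subset inf_le1)
      qed
      moreover have "(\<Sum>i\<in>D - R. a i) + (\<Sum>i\<in>D \<inter> R. a i) = (\<Sum>i\<in>D. a i)"
        using sum.Int_Diff[OF finD, of a R] by simp
      ultimately show ?thesis
        using DR True unfolding tight_def by linarith
    qed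
  next
    case True
    then obtain J0 where J0: "act J0 \<and> J0 \<noteq> D" by blast
    have "\<forall>J. act J \<and> J \<noteq> D \<longrightarrow> card J < Suc (card D)"
      using card_mono[OF finD] unfolding act_def less_Suc_eq_le by blast
    from ex_has_greatest_nat[of "\<lambda>J. act J \<and> J \<noteq> D", OF J0 this]
    obtain D1 where D1: "act D1" "D1 \<noteq> D" and
      D1_max: "\<And>J. act J \<Longrightarrow> J \<noteq> D \<Longrightarrow> card J \<le> card D1"
      by blast
    define C where "C = {J. act J \<and> J \<subseteq> D - D1}"
    define M where "M = {E \<in> C. \<forall>J\<in>C. E \<subseteq> J \<longrightarrow> E = J}"
    define F where "F = insert D1 M"
    have finC: "finite C"
      by (rule finite_subset[of _ "Pow D"]) (auto simp: C_def finD)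
    have C_le_M: "\<exists>E\<in>M. J \<subseteq> E" if "J \<in> C" for J
      using finite_has_maximal2[OF finC that] unfolding M_def by auto
    have act_Un: "act (I \<union> J)" if "act I" "act J" "I \<inter> J \<noteq> {}" for I J
      using that tight_Un_Int(1) unfolding act_def by blast
    have C: "act E" "E \<subseteq> D - D1" "E \<noteq> {}" if "E \<in> C" for E
      using that unfolding C_def act_def by auto
    have M: "E \<in> C" "\<And>J. J \<in> C \<Longrightarrow> E \<subseteq> J \<Longrightarrow> E = J" if "E \<in> M" for E
      using that unfolding M_def by simp_all
    have D1_D: "D1 \<subseteq> D" "D1 \<noteq> {}"
      using D1(1) unfolding act_def by auto
    have F_act: "act E \<and> E \<subset> D" if "E \<in> F" for E
    proof (cases "E = D1")
      case True
      then show ?thesis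
        using D1 D1_D by auto
    next
      case False
      then have "E \<in> C"
        using that M(1) unfolding F_def by auto
      then show ?thesis
        using C[of E] D1_D by auto
    qed
    have M_disj: "E \<inter> E' = {}" if "E \<in> M" "E' \<in> M" "E \<noteq> E'" for E E'
    proof (rule ccontr)
      assume "E \<inter> E' \<noteq> {}"
      then have "act (E \<union> E')" "E \<union> E' \<subseteq> D - D1"
        using act_Un C[OF M(1)[OF that(1)]] C[OF M(1)[OF that(2)]] by auto
      then have "E \<union> E' \<in> C"
        by (simp add: C_def)
      then show False
        using M(2)[OF that(1), of "E \<union> E'"] M(2)[OF that(2), of "E \<union> E'"] that(3) by auto
    qed
    have F_disj: "E \<inter> E' = {}" if "E \<in> F" "E' \<in> F" "E \<noteq> E'" for E E'
    proof -
      have "E = D1 \<or> E \<in> M \<and> E \<inter> D1 = {}" "E' = D1 \<or> E' \<in> M \<and> E' \<inter> D1 = {}"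
        using that(1,2) C(2) M(1) unfolding F_def by blast+
      then show ?thesis
        using M_disj that(3) by blast
    qed
    have finF: "finite F" "F \<noteq> {}"
      using finC unfolding F_def M_def by auto
    let ?V = "\<Union>F"
    have cover: "?u ?V - good D \<subseteq> (\<Union>E\<in>F. ?u E - good E)"
    proof
      fix y assume y: "y \<in> ?u ?V - good D"
      then obtain E where E: "E \<in> F" "y \<in> ?u E" by blast
      show "y \<in> (\<Union>E\<in>F. ?u E - good E)"
      proof (cases "y \<in> good E")
        case True
        then have "y \<in> ?u (D - R)"
          using F_act[OF E(1)] unfolding good_def by blast
        then obtain J where J: "J \<subseteq> D" "tight J" "y \<in> ?u (J - R)" "y \<notin> ?u (J \<inter> R)"
          using y unfolding good_def by blast
        then have actJ: "act J"
          unfolding act_def by blast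
        have "tight E" "E \<noteq> {}"
          using F_act[OF E(1)] unfolding act_def tight_def by blast+
        \<comment> \<open>Otherwise \<open>J \<inter> E\<close> would be tight and witness that
          \<open>y\<close> is not good in \<open>E\<close>.\<close>
        have JE: "J \<inter> E = {}"
        proof (rule ccontr)
          assume ne: "J \<inter> E \<noteq> {}"
          have "y \<in> ?u (J \<inter> E)"
            using tight_Un_Int(3)[OF J(2) \<open>tight E\<close> ne] J(3) E(2) by blast
          moreover have "y \<notin> ?u ((J \<inter> E) \<inter> R)"
            using J(4) by blast
          ultimately have "y \<in> ?u ((J \<inter> E) - R)" "y \<notin> ?u ((J \<inter> E) \<inter> R)"
            by blast+
          then show False
            using True tight_Un_Int(2)[OF J(2) \<open>tight E\<close> ne] unfolding good_def by blast
        qed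
        \<comment> \<open>If \<open>J\<close> meets \<open>D1\<close>, then
          \<open>J \<union> D1\<close> misses \<open>E\<close>, hence is proper, and maximality of
          \<open>D1\<close> gives \<open>J \<subseteq> D1\<close>.\<close>
        have "\<exists>E'\<in>F. J \<subseteq> E'"
        proof (cases "J \<inter> D1 = {}")
          case True
          then have "J \<in> C"
            using actJ J(1) unfolding C_def by blast
          then show ?thesis
            using C_le_M unfolding F_def by blast
        next
          case False
          then have un: "act (J \<union> D1)" and "E \<noteq> D1"
            using act_Un actJ D1(1) JE by blast+
          then have "E \<subseteq> D - D1"
            using E(1) C(2) M(1) unfolding F_def by blast
          then have "J \<union> D1 \<noteq> D"
            using JE \<open>E \<noteq> {}\<close> by blast
          then have "card (J \<union> D1) \<le> card D1"
            using D1_max[OF un] by blast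
          moreover have "finite (J \<union> D1)"
            using un finD unfolding act_def by (blast intro: finite_subset)
          ultimately have "D1 = J \<union> D1"
            by (intro card_seteq) auto
          then show ?thesis
            unfolding F_def by blast
        qed
        then obtain E' where "E' \<in> F" "J \<subseteq> E'" by blast
        moreover from this have "y \<notin> good E'"
          using J unfolding good_def by blast
        ultimately show ?thesis
          using J(3) by blast
      qed (use E in blast)
    qed
    \<comment> \<open>Tightness of \<open>E\<close> leaves a(E) + \<open>s\<close> elements, at
      least \<open>Suc s\<close> of them good by induction.\<close>
    have each: "card (?u E - good E) + 1 \<le> (\<Sum>i\<in>E. a i)" if "E \<in> F" for E
    proof -
      have "Suc s \<le> card (good E)"
        using F_act[OF that] less.prems finD unfolding act_def
        by (intro less.hyps psubset_card_mono) auto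
      moreover have "card (?u E) = (\<Sum>i\<in>E. a i) + s"
        using F_act[OF that] unfolding act_def tight_def by blast
      moreover have "card (?u E - good E) = card (?u E) - card (good E)"
        using finite_subset[OF good_sub fin] good_sub F_act[OF that] by (intro card_Diff_subset) auto
      moreover have "card (good E) \<le> card (?u E)"
        using good_sub fin F_act[OF that] by (intro card_mono) auto
      ultimately show ?thesis
        by linarith
    qed
    have VD: "?V \<subseteq> D"
      using F_act by blast
    have "?V \<noteq> {}"
      using D1_D(2) unfolding F_def by auto
    have "finite (\<Union>E\<in>F. ?u E - good E)"
      by (rule finite_UN_I[OF finF(1) finite_Diff[OF fin]]) (use F_act in blast)
    then have "card (?u ?V - good D) \<le> card (\<Union>E\<in>F. ?u E - good E)"
      using cover by (rule card_mono)
    also have "\<dots> \<le> (\<Sum>E\<in>F. card (?u E - good E))"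
      by (rule card_UN_le[OF finF(1)])
    finally have "card (?u ?V - good D) + card F \<le> (\<Sum>E\<in>F. card (?u E - good E) + 1)"
      by (subst sum.distrib) simp
    also have "\<dots> \<le> (\<Sum>E\<in>F. \<Sum>i\<in>E. a i)"
      by (intro sum_mono each)
    also have "\<dots> = (\<Sum>i\<in>?V. a i)"
    proof -
      have "\<forall>E\<in>F. finite E"
        using F_act finD by (meson finite_subset psubset_imp_subset)
      then show ?thesis
        using sum.Union_disjoint[of F a] F_disj by auto
    qed
    finally have "card (?u ?V - good D) + card F \<le> (\<Sum>i\<in>?V. a i)" .
    moreover have "(\<Sum>i\<in>?V. a i) + s \<le> card (?u ?V)"
      using VD less.prems \<open>?V \<noteq> {}\<close> by (intro lower) auto
    moreover have "card (?u ?V) \<le> card (?u ?V - good D) + card (good D)"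
    proof -
      have "card (?u ?V) \<le> card ((?u ?V - good D) \<union> good D)"
        using fin[OF VD] finite_subset[OF good_sub fin[OF order_refl]] by (intro card_mono) auto
      then show ?thesis
        using card_Un_le order_trans by blast
    qed
    \<comment> \<open>One element is saved for each member of \<open>F\<close>, so a single member
      already lifts \<open>s\<close> to \<open>Suc s\<close>.\<close>
    moreover have "card F > 0"
      using finF by (simp add: card_gt_0_iff)
    ultimately show ?thesis
      by linarith
  qed
qed

end

section \<open>The potential and the lower bound\<close>

definition potential :: "'i set \<Rightarrow> 'i set \<Rightarrow> ('i \<Rightarrow> 'a set) \<Rightarrow> nat" where
  "potential N R B = nsdr N B + (\<Sum>j\<in>R. nsdr (N - {j}) B)"

text \<open>Processed sets are spared since they have lost their element already; in the end every
  set has lost exactly one.\<close>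

definition peel :: "'i set \<Rightarrow> 'a \<Rightarrow> ('i \<Rightarrow> 'a set) \<Rightarrow> 'i \<Rightarrow> 'a set" where
  "peel R y B i = (if i \<in> R then B i else B i - {y})"

text \<open>\<open>nsdr_remove\<close> is applied to \<open>N\<close>, to every
  \<open>N - {j}\<close> and, backwards, to every \<open>N - {k}\<close> after the peel. The double
  sums cancel except where \<open>y\<close> is not in \<open>B j\<close>; this remainder is the drop
  of the potential.\<close>

lemma potential_peel:
  fixes y :: 'a and B :: "'i \<Rightarrow> 'a set"
  assumes N: "finite N" "\<And>i. i \<in> N \<Longrightarrow> finite (B i)" and R: "R \<subseteq> N"
  defines "K \<equiv> {k \<in> N - R. y \<in> B k}" and "C \<equiv> \<lambda>i. B i - {y}"
  shows "potential N R B = potential N (R \<union> K) (peel R y B)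
    + (\<Sum>k\<in>K. \<Sum>j | j \<in> R \<and> y \<notin> B j. nsdr (N - {k} - {j}) C)"
proof -
  let ?B = "peel R y B"
  have K: "K \<subseteq> N - R" and finK: "finite K" and finR: "finite R"
    using N(1) R finite_subset by (auto simp: K_def)
  have remove: "nsdr J B = nsdr J ?B + (\<Sum>k\<in>K. nsdr (J - {k}) C)" if "K \<subseteq> J" "J \<subseteq> N" for J
    unfolding C_def
  proof (rule nsdr_remove)
    show "?B i = (if i \<in> K then B i - {y} else B i)" if "i \<in> J" for i
      using that \<open>J \<subseteq> N\<close> by (auto simp: K_def peel_def)
  qed (use that N in \<open>auto simp: K_def intro: finite_subset\<close>)
  have K_part: "nsdr (N - {k}) ?B = nsdr (N - {k}) C + (\<Sum>j | j \<in> R \<and> y \<in> B j. nsdr (N - {k} - {j}) C)"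
    if "k \<in> K" for k
  proof -
    have C: "(\<lambda>i. ?B i - {y}) = C"
      by (auto simp: C_def peel_def fun_eq_iff)
    show ?thesis
      unfolding C[symmetric]
    proof (rule nsdr_remove)
      show "?B i - {y} = (if i \<in> {j \<in> R. y \<in> B j} then ?B i - {y} else ?B i)" for i
        by (auto simp: peel_def)
    qed (use N R K that in \<open>auto simp: peel_def\<close>)
  qed
  have R_part: "nsdr (N - {j}) B = nsdr (N - {j}) ?B + (\<Sum>k\<in>K. nsdr (N - {k} - {j}) C)" if "j \<in> R" for j
  proof -
    have "N - {j} - {k} = N - {k} - {j}" for k by blast
    then show ?thesis
      using remove[of "N - {j}"] K R that by auto
  qed
  have split: "(\<Sum>j\<in>R. f j) = (\<Sum>j | j \<in> R \<and> y \<in> B j. f j) + (\<Sum>j | j \<in> R \<and> y \<notin> B j. f j)" for f :: "'i \<Rightarrow> nat"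
    using sum.Int_Diff[OF finR, of f "{j. y \<in> B j}"] by (simp add: Int_def set_diff_eq)
  have "potential N R B = nsdr N ?B + (\<Sum>k\<in>K. nsdr (N - {k}) C) + (\<Sum>j\<in>R. nsdr (N - {j}) ?B)
      + (\<Sum>k\<in>K. \<Sum>j\<in>R. nsdr (N - {k} - {j}) C)"
    unfolding potential_def remove[OF order_trans[OF K Diff_subset] order_refl]
    by (simp add: R_part sum.distrib sum.swap[of _ K R])
  also have "\<dots> = nsdr N ?B + (\<Sum>j\<in>R. nsdr (N - {j}) ?B) + (\<Sum>k\<in>K. nsdr (N - {k}) ?B)
      + (\<Sum>k\<in>K. \<Sum>j | j \<in> R \<and> y \<notin> B j. nsdr (N - {k} - {j}) C)"
    by (simp add: K_part split sum.distrib)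
  also have "nsdr N ?B + (\<Sum>j\<in>R. nsdr (N - {j}) ?B) + (\<Sum>k\<in>K. nsdr (N - {k}) ?B) = potential N (R \<union> K) ?B"
    unfolding potential_def using K finK finR by (subst sum.union_disjoint) auto
  finally show ?thesis .
qed

text \<open>A subfamily that is not tight can afford to lose \<open>y\<close>; a tight one keeps
  \<open>y\<close> in a processed set because \<open>y\<close> is good.\<close>

lemma (in peeling) peeling_peel:
  assumes y: "y \<in> good N"
  shows "peeling N (R \<union> {k \<in> N - R. y \<in> B k}) (peel R y B) a s"
proof
  let ?B = "peel R y B"
  show "surplus a s N ?B"
    unfolding surplus_def
  proof (intro conjI allI impI)
    fix I assume I: "I \<subseteq> N" "I \<noteq> {}"
    have eq: "\<Union>(?B ` I) = \<Union>(B ` (I \<inter> R)) \<union> (\<Union>(B ` I) - {y})"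
      by (auto simp: peel_def)
    show "(\<Sum>i\<in>I. a i) + s \<le> card (\<Union>(?B ` I))"
    proof (cases "tight I \<and> y \<in> \<Union>(B ` I)")
      case True
      then have "y \<in> \<Union>(B ` (I \<inter> R))"
        using y I unfolding good_def by blast
      then have "\<Union>(?B ` I) = \<Union>(B ` I)"
        unfolding eq by blast
      then show ?thesis
        using lower[OF I] by simp
    next
      case False
      then have "(\<Sum>i\<in>I. a i) + s \<le> card (\<Union>(B ` I) - {y})"
        using lower[OF I] I finite_UN_B[OF I(1)] unfolding tight_def
        by (cases "y \<in> \<Union>(B ` I)") (auto simp: card_Diff_singleton)
      also have "\<dots> \<le> card (\<Union>(?B ` I))"
        unfolding eq using finite_UN_B[OF I(1)] finite_UN_B[OF le_infI1[OF I(1)], of R]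
        by (intro card_mono finite_UnI) auto
      finally show ?thesis .
    qed
  qed (use finN finB in \<open>auto simp: peel_def\<close>)
  \<comment> \<open>The sets that remain unprocessed do not contain \<open>y\<close>, so they are
    unchanged.\<close>
  show "surplus a (Suc s) (N - (R \<union> {k \<in> N - R. y \<in> B k})) ?B"
    using surplus_subset[OF surplus_Suc] by (rule surplus_cong) (auto simp: peel_def)
  show "R \<union> {k \<in> N - R. y \<in> B k} \<subseteq> N"
    using RN by auto
qed

text \<open>Good elements are peeled until \<open>R = N\<close>, where the bound for surplus
  \<open>s\<close> applies to each term of the potential and gives the recursion of
  \<open>U_rec\<close>. The start may be any intermediate stage, as the equality case
  requires.\<close>

lemma U_rec_le_potential:
  fixes B :: "'i \<Rightarrow> 'a set"
  assumes IH: "\<And>J (A :: 'i \<Rightarrow> 'a set). surplus a s J A \<Longrightarrow> U_rec a s J \<le> nsdr J A"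
    and "peeling N R B a s"
  shows "U_rec a (Suc s) N \<le> potential N R B"
  using assms(2)
proof (induction "card (N - R)" arbitrary: R B rule: less_induct)
  case less
  interpret peeling N R B a s by (rule less.prems)
  show ?case
  proof (cases "R = N")
    case True
    then show ?thesis
      using IH surplus surplus_subset[OF surplus] by (auto simp: potential_def intro!: add_mono sum_mono)
  next
    case False
    then have "good N \<noteq> {}"
      using card_good[of N] RN by force
    then obtain y where y: "y \<in> good N" by blast
    let ?R = "R \<union> {k \<in> N - R. y \<in> B k}"
    have "N - ?R \<subset> N - R"
      using y unfolding good_def by blast
    then have "U_rec a (Suc s) N \<le> potential N ?R (peel R y B)"
      using finN by (intro less.hyps peeling_peel y psubset_card_mono) auto
    then show ?thesis
      using potential_peel[where B = B and y = y, OF finN finB RN] by simp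
  qed
qed

lemma U_rec_le_nsdr:
  "surplus a t N A \<Longrightarrow> U_rec a t N \<le> nsdr N A"
proof (induction t arbitrary: N A)
  case 0
  then show ?case by (simp add: prod_le_nsdr)
next
  case (Suc t)
  have "surplus a t N A"
    using Suc.prems by (rule surplus_mono) simp
  then have "peeling N {} A a t"
    using Suc.prems by unfold_locales auto
  from U_rec_le_potential[OF Suc.IH this] show ?case
    by (simp add: potential_def)
qed

section \<open>The extremal families\<close>

lemma equality_imp_core:
  assumes A: "surplus a (Suc s) N A" and s: "s > 0" and pos: "\<And>i. i \<in> N \<Longrightarrow> a i > 0"
    and card_A: "\<And>i. i \<in> N \<Longrightarrow> card (A i) = a i + Suc s"
    and card_Int: "\<And>i j. i \<in> N \<Longrightarrow> j \<in> N \<Longrightarrow> i \<noteq> j \<Longrightarrow> card (A i \<inter> A j) \<le> Suc s"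
    and N2: "p \<in> N" "q \<in> N" "p \<noteq> q" and eq: "nsdr N A = U_rec a (Suc s) N"
  shows "card (\<Inter>i\<in>N. A i) = Suc s \<and> (\<forall>i\<in>N. \<forall>j\<in>N. i \<noteq> j \<longrightarrow> A i \<inter> A j = (\<Inter>i\<in>N. A i))"
proof -
  define X where "X y = {i \<in> N. y \<in> A i}" for y
  let ?T = "\<Inter>i\<in>N. A i"
  have finN: "finite N" and finA: "\<And>i. i \<in> N \<Longrightarrow> finite (A i)"
    using A by (auto simp: surplus_def)
  interpret P0: peeling N "{}" A a s
    using A surplus_mono[OF A, of s] by unfold_locales simp_all
  have common: "\<exists>Z. Suc s \<le> card Z \<and> Z \<subseteq> \<Union>(A ` (N - X y)) \<and> (\<forall>j\<in>X y. Z \<subseteq> A j - {y})"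
    if y: "y \<in> \<Union>(A ` N)" "X y \<noteq> N" for y
  proof -
    define R B where "R = X y" and "B = (\<lambda>i. A i - {y})"
    \<comment> \<open>With nothing processed all unions have surplus \<open>Suc s\<close>, so every
      element is good.\<close>
    have "\<not> P0.tight J" for J
    proof
      assume J: "P0.tight J"
      then have "J \<subseteq> N - {}" "J \<noteq> {}"
        unfolding P0.tight_def by auto
      then show False
        using P0.lower_Suc[of J] J unfolding P0.tight_def by linarith
    qed
    then have "y \<in> P0.good N"
      using y(1) unfolding P0.good_def by simp
    have B: "peel {} y A = B"
      by (simp add: B_def peel_def fun_eq_iff)
    have R: "{} \<union> {k \<in> N - {}. y \<in> A k} = R"
      by (simp add: R_def X_def)
    interpret P1: peeling N R B a s
      using P0.peeling_peel[OF \<open>y \<in> P0.good N\<close>] unfolding B R .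
    \<comment> \<open>The first peel has no drop, since the drop sums over processed
      \<open>j\<close>.\<close>
    have pot: "potential N R B = U_rec a (Suc s) N"
      using potential_peel[where B = A and y = y, OF finN finA empty_subsetI] eq
      unfolding B R by (simp add: potential_def del: U_rec.simps)
    have "N - R \<noteq> {}"
      using y(2) unfolding R_def X_def by blast
    then have card_Z: "Suc s \<le> card (P1.good N)"
      by (intro P1.card_good) auto
    \<comment> \<open>A good \<open>z\<close> missing from a processed set would push the potential
      below its lower bound.\<close>
    have "z \<in> B j" if z: "z \<in> P1.good N" and j: "j \<in> R" for z j
    proof (rule ccontr)
      assume zj: "z \<notin> B j"
      let ?K = "{k \<in> N - R. z \<in> B k}" and ?C = "\<lambda>i. B i - {z}"
      obtain k where k: "k \<in> ?K"
        using z unfolding P1.good_def by blast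
      have "U_rec a (Suc s) N \<le> potential N (R \<union> ?K) (peel R z B)"
        by (rule U_rec_le_potential[OF U_rec_le_nsdr P1.peeling_peel[OF z]])
      then have "(\<Sum>k\<in>?K. \<Sum>j | j \<in> R \<and> z \<notin> B j. nsdr (N - {k} - {j}) ?C) = 0"
        using potential_peel[where B = B and y = z, OF finN P1.finB P1.RN] pot by simp
      then have "(\<Sum>j | j \<in> R \<and> z \<notin> B j. nsdr (N - {k} - {j}) ?C) = 0"
        using k finN by simp
      then have "nsdr (N - {k} - {j}) ?C = 0"
        using j zj finN P1.RN by (simp add: finite_subset)
      \<comment> \<open>Here \<open>s > 0\<close> enters: after the removal of \<open>z\<close> a
        surplus of \<open>s - 1\<close> remains, so an SDR exists and the drop is positive.\<close>
      moreover have "surplus a 0 (N - {k} - {j}) ?C"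
      proof -
        have "surplus a (s - 1) N ?C"
          using P1.surplus s by (intro surplus_remove) simp
        then show ?thesis
          by (rule surplus_mono[OF surplus_subset]) auto
      qed
      then have "(\<Prod>i\<in>N - {k} - {j}. a i) \<le> nsdr (N - {k} - {j}) ?C"
        by (rule prod_le_nsdr)
      moreover have "(\<Prod>i\<in>N - {k} - {j}. a i) > 0"
        by (rule prod_pos) (use pos in auto)
      ultimately show False
        by simp
    qed
    moreover have "P1.good N \<subseteq> \<Union>(A ` (N - X y))"
      unfolding P1.good_def by (auto simp: R_def B_def)
    ultimately show ?thesis
      using card_Z unfolding R_def B_def by blast
  qed
  \<comment> \<open>Otherwise \<open>Z\<close> together with \<open>y\<close> would be more than
    \<open>Suc s\<close> common elements of \<open>A i\<close> and \<open>A j\<close>.\<close>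
  have X_full: "X y = N" if "i \<in> N" "j \<in> N" "i \<noteq> j" "y \<in> A i" "y \<in> A j" for i j y
  proof (rule ccontr)
    assume "X y \<noteq> N"
    moreover have "y \<in> \<Union>(A ` N)"
      using that by blast
    ultimately obtain Z where Z: "Suc s \<le> card Z" "\<forall>j\<in>X y. Z \<subseteq> A j - {y}"
      using common by meson
    moreover have "i \<in> X y" "j \<in> X y"
      using that by (auto simp: X_def)
    ultimately have "insert y Z \<subseteq> A i \<inter> A j" "y \<notin> Z"
      using that(4,5) by auto
    then have "card (insert y Z) \<le> card (A i \<inter> A j)" "finite Z"
      using finA[OF that(1)] by (auto intro: card_mono finite_subset)
    then show False
      using card_Int[OF that(1-3)] Z(1) \<open>y \<notin> Z\<close> by simp
  qed
  have Int_eq: "A i \<inter> A j = ?T" if "i \<in> N" "j \<in> N" "i \<noteq> j" for i j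
    using X_full[OF that] that unfolding X_def by blast
  \<comment> \<open>\<open>common\<close> needs an element that is not in all sets; positivity of
    \<open>a p\<close> makes \<open>A p\<close> larger than its intersection with
    \<open>A q\<close>.\<close>
  have "\<not> A p \<subseteq> A q"
  proof
    assume "A p \<subseteq> A q"
    then have "A p \<inter> A q = A p" by blast
    then show False
      using card_Int[OF N2] card_A[OF N2(1)] pos[OF N2(1)] by simp
  qed
  then obtain y where y: "y \<in> A p" "y \<notin> A q" by blast
  then have "y \<in> \<Union>(A ` N)" "X y \<noteq> N"
    using N2 unfolding X_def by auto
  then obtain Z where Z: "Suc s \<le> card Z" "Z \<subseteq> \<Union>(A ` (N - X y))" "\<forall>j\<in>X y. Z \<subseteq> A j - {y}"
    using common by meson
  have "p \<in> X y"
    using y N2 by (simp add: X_def)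
  \<comment> \<open>Each \<open>z\<close> lies in \<open>A p\<close> and in a set without
    \<open>y\<close>, so in two different sets and hence in all.\<close>
  have "Z \<subseteq> ?T"
  proof
    fix z assume z: "z \<in> Z"
    then obtain k where "k \<in> N - X y" "z \<in> A k"
      using Z(2) by blast
    moreover have "z \<in> A p"
      using z Z(3) \<open>p \<in> X y\<close> by blast
    ultimately show "z \<in> ?T"
      using Int_eq[of p k] N2(1) \<open>p \<in> X y\<close> by blast
  qed
  moreover have "finite ?T"
    using finA[OF N2(1)] N2(1) by (blast intro: finite_subset)
  ultimately have "card Z \<le> card ?T"
    by (intro card_mono)
  then have "Suc s \<le> card ?T"
    using Z(1) by linarith
  moreover have "card ?T \<le> Suc s"
    using card_Int[OF N2] Int_eq[OF N2] by simp
  ultimately show ?thesis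
    using Int_eq by auto
qed

section \<open>Valued families\<close>

lemma valued_family_surplus:
  assumes A: "valued_family t n a A" and pos: "\<And>i. i \<in> {1..n} \<Longrightarrow> a i > 0"
  shows "surplus a t {1..n} A"
  unfolding surplus_def
proof (intro conjI ballI allI impI)
  show fin: "finite (A i)" if "i \<in> {1..n}" for i
    using A pos[OF that] that by (intro card_ge_0_finite) (auto simp: valued_family_def)
  fix I assume I: "I \<subseteq> {1..n}" "I \<noteq> {}"
  then have "card I > 0"
    by (auto simp: card_gt_0_iff intro: finite_subset)
  \<comment> \<open>The union condition starts at two sets; for one set the prescribed size gives
    the bound.\<close>
  then consider "card I = 1" | "card I \<ge> 2"
    by linarith
  then show "(\<Sum>i\<in>I. a i) + t \<le> card (\<Union>(A ` I))"
  proof cases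
    case 1
    then obtain i where "I = {i}"
      by (auto simp: card_1_singleton_iff)
    then show ?thesis
      using A I by (simp add: valued_family_def)
  next
    case 2
    then show ?thesis
      using A I by (simp add: valued_family_def)
  qed
qed simp

lemma card_UN_core:
  assumes "finite I" "I \<noteq> {}" "\<And>i. i \<in> I \<Longrightarrow> finite (A i) \<and> T \<subseteq> A i \<and> card (A i) = a i + card T"
    and "\<And>i j. i \<in> I \<Longrightarrow> j \<in> I \<Longrightarrow> i \<noteq> j \<Longrightarrow> A i \<inter> A j \<subseteq> T"
  shows "card (\<Union>i\<in>I. A i) = (\<Sum>i\<in>I. a i) + card T"
proof -
  have finT: "finite T"
    using assms(2,3) by (meson ex_in_conv finite_subset)
  have "card (\<Union>i\<in>I. A i - T) = (\<Sum>i\<in>I. card (A i - T))"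
  proof (rule card_UN_disjoint)
    show "\<forall>i\<in>I. \<forall>j\<in>I. i \<noteq> j \<longrightarrow> (A i - T) \<inter> (A j - T) = {}"
      using assms(4) by blast
  qed (use assms in simp_all)
  also have "\<dots> = (\<Sum>i\<in>I. a i)"
    using assms(3) finT by (intro sum.cong refl) (simp add: card_Diff_subset)
  finally have "card (\<Union>i\<in>I. A i - T) = (\<Sum>i\<in>I. a i)" .
  moreover have "card ((\<Union>i\<in>I. A i - T) \<union> T) = card (\<Union>i\<in>I. A i - T) + card T"
    using assms finT by (intro card_Un_disjoint) auto
  moreover have "(\<Union>i\<in>I. A i) = (\<Union>i\<in>I. A i - T) \<union> T"
    using assms(2,3) by blast
  ultimately show ?thesis
    by argo
qed

text \<open>The kernel is \<open>{..<t}\<close>, and the petals are coded pairs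
  \<open>(i, k)\<close>, shifted by \<open>t\<close> to stay clear of it.\<close>

lemma ex_core_family:
  "\<exists>A :: nat \<Rightarrow> nat set. valued_family t n a A \<and> num_SDRs n A = U' t n a"
proof -
  define g where "g p = t + prod_encode p" for p
  define A where "A i = {..<t} \<union> g ` ({i} \<times> {..<a i})" for i
  have inj: "inj_on g P" for P
    by (auto simp: g_def inj_on_def)
  have card_A: "finite (A i) \<and> {..<t} \<subseteq> A i \<and> card (A i) = a i + card {..<t}" for i
  proof -
    have "card (A i) = card {..<t} + card (g ` ({i} \<times> {..<a i}))"
      unfolding A_def by (intro card_Un_disjoint) (auto simp: g_def)
    then show ?thesis
      by (simp add: A_def card_image[OF inj] card_cartesian_product)
  qed
  have Int_A: "A i \<inter> A j \<subseteq> {..<t}" if "i \<noteq> j" for i j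
    using that by (auto simp: A_def g_def)
  have "valued_family t n a A"
    unfolding valued_family_def
  proof (intro conjI ballI allI impI)
    fix I assume "I \<subseteq> {1..n}" "2 \<le> card I"
    then have "finite I" "I \<noteq> {}"
      by (auto intro: finite_subset)
    then show "(\<Sum>i\<in>I. a i) + t \<le> card (\<Union>i\<in>I. A i)"
      using card_UN_core[of I A "{..<t}" a] card_A Int_A by simp
  qed (use card_A in simp)
  moreover have "num_SDRs n A = U' t n a"
    using nsdr_core[of "{1..n}" "{..<t}" A a] card_A Int_A by (simp add: num_SDRs_eq_nsdr U'_eq_U_rec)
  ultimately show ?thesis
    by blast
qed

text \<open>The common intersection serves as kernel: it has \<open>t\<close> elements, as has each
  pairwise intersection containing it, so they coincide.\<close>

lemma num_SDRs_F_bar: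
  assumes A: "is_F_bar t n a A" and pos: "\<And>i. i \<in> {1..n} \<Longrightarrow> a i > 0" and n: "n \<ge> 1"
  shows "num_SDRs n A = U' t n a"
proof -
  have val: "valued_family t n a A" and
    core: "\<And>I. I \<subseteq> {1..n} \<Longrightarrow> card I \<ge> 2 \<Longrightarrow> card (\<Inter>i\<in>I. A i) = t"
    using A unfolding is_F_bar_def by auto
  have fin: "finite (A i)" if "i \<in> {1..n}" for i
    using valued_family_surplus[OF val pos] that by (simp add: surplus_def)
  have card_A: "card (A i) = a i + t" if "i \<in> {1..n}" for i
    using val that by (simp add: valued_family_def)
  have "\<exists>T. finite T \<and> card T = t \<and> (\<forall>i\<in>{1..n}. T \<subseteq> A i) \<and>
      (\<forall>i\<in>{1..n}. \<forall>j\<in>{1..n}. i \<noteq> j \<longrightarrow> A i \<inter> A j \<subseteq> T)"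
  proof (cases "n = 1")
    case True
    \<comment> \<open>For \<open>n = 1\<close> no intersection is prescribed, and any
      \<open>t\<close> elements of \<open>A 1\<close> serve as kernel.\<close>
    then obtain T where "T \<subseteq> A 1" "card T = t" "finite T"
      using obtain_subset_with_card_n[of t "A 1"] card_A[of 1] by auto
    then show ?thesis
      using True by (intro exI[of _ T]) auto
  next
    case False
    let ?T = "\<Inter>i\<in>{1..n}. A i"
    have finT: "finite ?T"
      using fin[of 1] n by (meson INF_lower atLeastAtMost_iff finite_subset le_refl)
    have card_T: "card ?T = t"
      using core[of "{1..n}"] n False by simp
    have "A i \<inter> A j \<subseteq> ?T" if ij: "i \<in> {1..n}" "j \<in> {1..n}" "i \<noteq> j" for i j
    proof -
      have "card (A i \<inter> A j) = t"
        using core[of "{i, j}"] ij by simp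
      moreover have "?T \<subseteq> A i \<inter> A j"
        using ij by blast
      ultimately have "?T = A i \<inter> A j"
        using card_T fin[OF ij(1)] by (intro card_subset_eq) auto
      then show ?thesis
        by blast
    qed
    then show ?thesis
      using finT card_T by (intro exI[of _ ?T]) blast
  qed
  then obtain T where T: "finite T" "card T = t" "\<forall>i\<in>{1..n}. T \<subseteq> A i"
    "\<forall>i\<in>{1..n}. \<forall>j\<in>{1..n}. i \<noteq> j \<longrightarrow> A i \<inter> A j \<subseteq> T"
    by (elim exE conjE)
  have "nsdr {1..n} A = U_rec a (card T) {1..n}"
  proof (rule nsdr_core)
    show "finite (A i) \<and> T \<subseteq> A i \<and> card (A i) = a i + card T" if "i \<in> {1..n}" for i
      using that fin[OF that] card_A[OF that] T(2,3) by simp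
    show "A i \<inter> A j \<subseteq> T" if "i \<in> {1..n}" "j \<in> {1..n}" "i \<noteq> j" for i j
      using T(4)[rule_format, OF that] .
  qed (use T in simp_all)
  then show ?thesis
    using T(2) by (simp add: num_SDRs_eq_nsdr U'_eq_U_rec)
qed

lemma F_bar_if_minimal:
  assumes A: "valued_family t n a A" and pos: "\<And>i. i \<in> {1..n} \<Longrightarrow> a i > 0" and t: "t \<ge> 2"
    and eq: "num_SDRs n A = U' t n a"
  shows "is_F_bar t n a A"
proof -
  obtain s where s: "t = Suc s" "s > 0"
    using t by (cases t) auto
  have sur: "surplus a (Suc s) {1..n} A"
    using valued_family_surplus[OF A pos] s by simp
  have card_A: "card (A i) = a i + Suc s" if "i \<in> {1..n}" for i
    using A s that by (simp add: valued_family_def)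
  \<comment> \<open>The prescribed sizes and the lower bound for the union leave at most
    \<open>t\<close> common elements.\<close>
  have card_Int: "card (A i \<inter> A j) \<le> Suc s" if ij: "i \<in> {1..n}" "j \<in> {1..n}" "i \<noteq> j" for i j
  proof -
    have "a i + a j + Suc s \<le> card (A i \<union> A j)"
      using sur ij unfolding surplus_def by (auto dest!: spec[of _ "{i, j}"])
    moreover have "card (A i) + card (A j) = card (A i \<union> A j) + card (A i \<inter> A j)"
      using sur ij unfolding surplus_def by (intro card_Un_Int) auto
    ultimately show ?thesis
      using card_A[OF ij(1)] card_A[OF ij(2)] by linarith
  qed
  have "card (\<Inter>i\<in>I. A i) = t" if I: "I \<subseteq> {1..n}" "2 \<le> card I" for I
  proof -
    obtain p q where pq: "p \<in> I" "q \<in> I" "p \<noteq> q"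
    proof -
      obtain P where "P \<subseteq> I" "card P = 2"
        using obtain_subset_with_card_n[OF I(2)] by blast
      then show ?thesis
        using that by (auto simp: card_2_iff)
    qed
    let ?T = "\<Inter>i\<in>{1..n}. A i"
    have T: "card ?T = Suc s \<and> (\<forall>i\<in>{1..n}. \<forall>j\<in>{1..n}. i \<noteq> j \<longrightarrow> A i \<inter> A j = ?T)"
    proof (rule equality_imp_core[where p = p and q = q])
      show "nsdr {1..n} A = U_rec a (Suc s) {1..n}"
        using eq s by (simp add: num_SDRs_eq_nsdr U'_eq_U_rec)
    qed (use sur s pos card_A card_Int pq I in auto)
    have "A p \<inter> A q = ?T"
      using T pq I(1) by (meson subsetD)
    then have "(\<Inter>i\<in>I. A i) = ?T"
      using pq I(1) by blast
    then show ?thesis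
      using T s by simp
  qed
  then show ?thesis
    using A unfolding is_F_bar_def by blast
qed

theorem theorem4:
  fixes t n :: nat and a :: "nat \<Rightarrow> nat"
  assumes "t \<ge> 2" and "n \<ge> 1"
    and "\<And>i. i \<in> {1..n} \<Longrightarrow> a i > 0"
  shows "M' t n a = U' t n a \<and>
    (\<forall>A :: nat \<Rightarrow> 'a set. valued_family t n a A \<longrightarrow>
      (num_SDRs n A = M' t n a \<longleftrightarrow> is_F_bar t n a A))"
proof -
  have "M' t n a = U' t n a"
  proof (rule antisym)
    obtain A :: "nat \<Rightarrow> nat set" where A: "valued_family t n a A" "num_SDRs n A = U' t n a"
      using ex_core_family by blast
    show "M' t n a \<le> U' t n a"
      using M'_le[OF assms(3) A(1)] A(2) by simp
    obtain A :: "nat \<Rightarrow> nat set" where A: "valued_family t n a A" "num_SDRs n A = M' t n a"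
      using M'_attained by blast
    have "U_rec a t {1..n} \<le> nsdr {1..n} A"
      by (intro U_rec_le_nsdr valued_family_surplus A(1) assms(3))
    then show "U' t n a \<le> M' t n a"
      using A(2) by (simp add: num_SDRs_eq_nsdr U'_eq_U_rec)
  qed
  moreover have "num_SDRs n A = U' t n a \<longleftrightarrow> is_F_bar t n a A" if "valued_family t n a A" for A :: "nat \<Rightarrow> 'a set"
  proof
    show "is_F_bar t n a A" if "num_SDRs n A = U' t n a"
      by (rule F_bar_if_minimal[OF \<open>valued_family t n a A\<close> assms(3,1) that])
    show "num_SDRs n A = U' t n a" if "is_F_bar t n a A"
      by (rule num_SDRs_F_bar[OF that assms(3,2)])
  qed
  ultimately show ?thesis
    by simp
qed

end
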